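(* Let $f:[a,b]\to\mathbb{R}$ and let $n\geq2$ be an integer. Then $f$ is $CBVG_{1/n}$ if and only if $f$ is $SBVG_{1/n}$.
   Context: Points of varying monotonicity: $K_f$ is the set of $x\in[a,b]$ for which there is no open neighbourhood $U$ of $x$ such that $f|_U$ is constant or strictly monotone. By convention the endpoints $a,b$ always belong to $K_f$. The set $K_f$ is closed. Fractional variation: for $f:[a,b]\to\mathbb{R}$ continuous, $\alpha\in(0,1]$ and $K\subset[a,b]$, $V_\alpha(f,K)$ is the supremum of $\sum_{i=1}^N|f(d_i)-f(c_i)|^\alpha$ over all finite sequences of non-overlapping intervals $[c_i,d_i]\subset[a,b]$ with $c_i,d_i\in K$ (it is $0$ if there is no such sequence). Generalized variation ($n\ge2$): for closed sets $\emptyset\neq A\subset K\subset[a,b]$ and $\delta>0$, consider the sums $$\sum_{i=1}^N\Big(V_{\frac1{n-1}}(f,K\cap[x_i,y_i])\Big)^{\frac{n-1}{n}}\qquad( * )$$ for finite collections of non-overlapping intervals $[x_i,y_i]\subset[a,b]$. $GV_{1/n}(f,A,K)$ is the supremum of $( * )$ over collections with $x_i,y_i\in A$ for all $i$. $\overline{GV}^{\delta}_{1/n}(f,A,K)$ is the supremum of $( * )$ over collections with $y_i-x_i\leq\delta$, $x_i,y_i\in K$ and $\{x_i,y_i\}\cap A\neq\emptyset$ for all $i$. If there is no admissible collection the value is $0$; both are $0$ if $A=\emptyset$. Classes ($n\ge2$; both require $f:[a,b]\to\mathbb{R}$ continuous): - $f$ is $CBVG_{1/n}$ if $f$ is continuous,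 $V_{\frac1{n-1}}(f,K_f)<\infty$ and there are closed sets $A_m\subset K_f$ ($m\in\mathcal{M}\subset\mathbb{N}$) with $K_f=\bigcup_{m\in\mathcal{M}}A_m$ and $GV_{1/n}(f,A_m,K_f)<\infty$ for all $m\in\mathcal{M}$. - $f$ is $SBVG_{1/n}$ if $f$ is continuous, $V_{\frac1{n-1}}(f,K_f)<\infty$ and there are closed sets $A_m\subset K_f$ and numbers $\delta_m>0$ ($m\in\mathbb{N}$) with $K_f=\bigcup_m A_m$, $\lim_m\delta_m=0$, $A_m\subset A_{m+1}$ for each $m$, and $\lim_{m\to\infty}\overline{GV}^{\delta_m}_{1/n}(f,A_m,K_f)=0$. *)

theory Defs
  imports "HOL-Analysis.Analysis"
begin

text \<open>
  A function \<open>[a, b] \<rightarrow> \<real>\<close> is represented by \<open>f :: real \<Rightarrow> real\<close>, of which only the values on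
  \<open>{a..b}\<close> matter.
\<close>

definition varying_monotonicity :: "real \<Rightarrow> real \<Rightarrow> (real \<Rightarrow> real) \<Rightarrow> real set" where
  "varying_monotonicity a b f =
     {x \<in> {a..b}. x = a \<or> x = b \<or>
        \<not> (\<exists>U. openin (top_of_set {a..b}) U \<and> x \<in> U \<and>
               (f constant_on U \<or> strict_mono_on U f \<or> strict_antimono_on U f))}"

text \<open>
  A finite collection of non-overlapping intervals \<open>[c, d]\<close> is a finite set of pairs \<open>(c, d)\<close> with
  \<open>c < d\<close>; the intervals may share endpoints.  One-point intervals are left out: they contribute
  \<open>0\<close> to every sum below.
\<close>
definition nonoverlapping :: "(real \<times> real) set \<Rightarrow> bool" where
  "nonoverlapping P \<longleftrightarrow>
     finite P \<and> (\<forall>(c, d) \<in> P. c < d) \<and>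
     pairwise (\<lambda>(c, d) (c', d'). disjnt {c<..<d} {c'<..<d'}) P"

text \<open>
  The real power on \<open>[0, \<infinity>]\<close>, for exponents \<open>p > 0\<close>.
\<close>
definition ennreal_pow :: "ennreal \<Rightarrow> real \<Rightarrow> ennreal" where
  "ennreal_pow v p = (if v = \<infinity> then \<infinity> else ennreal (enn2real v powr p))"

text \<open>
  The interval \<open>[a, b]\<close> is not a parameter of the variations: for \<open>A \<subseteq> K \<subseteq> [a, b]\<close>, intervals with
  endpoints in \<open>K\<close> are contained in \<open>[a, b]\<close>.  The empty collection is always admissible with sum \<open>0\<close>,
  so each supremum is \<open>0\<close> if there is no other collection.
\<close>
definition frac_variation :: "real \<Rightarrow> (real \<Rightarrow> real) \<Rightarrow> real set \<Rightarrow> ennreal" where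
  "frac_variation \<alpha> f K =
     (SUP P \<in> {P. nonoverlapping P \<and> (\<forall>(c, d) \<in> P. c \<in> K \<and> d \<in> K)}.
        \<Sum>(c, d) \<in> P. ennreal (\<bar>f d - f c\<bar> powr \<alpha>))"

definition gv_sum :: "nat \<Rightarrow> (real \<Rightarrow> real) \<Rightarrow> real set \<Rightarrow> (real \<times> real) set \<Rightarrow> ennreal" where
  "gv_sum n f K P =
     (\<Sum>(x, y) \<in> P. ennreal_pow (frac_variation (1 / (real n - 1)) f (K \<inter> {x..y}))
                               ((real n - 1) / real n))"

definition GV :: "nat \<Rightarrow> (real \<Rightarrow> real) \<Rightarrow> real set \<Rightarrow> real set \<Rightarrow> ennreal" where
  "GV n f A K =
     (SUP P \<in> {P. nonoverlapping P \<and> (\<forall>(x, y) \<in> P. x \<in> A \<and> y \<in> A)}. gv_sum n f K P)"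

definition GV_bar :: "nat \<Rightarrow> real \<Rightarrow> (real \<Rightarrow> real) \<Rightarrow> real set \<Rightarrow> real set \<Rightarrow> ennreal" where
  "GV_bar n \<delta> f A K =
     (SUP P \<in> {P. nonoverlapping P \<and>
                   (\<forall>(x, y) \<in> P. y - x \<le> \<delta> \<and> x \<in> K \<and> y \<in> K \<and> {x, y} \<inter> A \<noteq> {})}.
        gv_sum n f K P)"

definition CBVG :: "nat \<Rightarrow> real \<Rightarrow> real \<Rightarrow> (real \<Rightarrow> real) \<Rightarrow> bool" where
  "CBVG n a b f \<longleftrightarrow>
     (let K = varying_monotonicity a b f in
       continuous_on {a..b} f \<and>
       frac_variation (1 / (real n - 1)) f K < \<infinity> \<and>
       (\<exists>(M :: nat set) A.
          (\<forall>m \<in> M. closed (A m) \<and> A m \<subseteq> K) \<and>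
          K = (\<Union>m \<in> M. A m) \<and>
          (\<forall>m \<in> M. GV n f (A m) K < \<infinity>)))"

definition SBVG :: "nat \<Rightarrow> real \<Rightarrow> real \<Rightarrow> (real \<Rightarrow> real) \<Rightarrow> bool" where
  "SBVG n a b f \<longleftrightarrow>
     (let K = varying_monotonicity a b f in
       continuous_on {a..b} f \<and>
       frac_variation (1 / (real n - 1)) f K < \<infinity> \<and>
       (\<exists>(A :: nat \<Rightarrow> real set) (\<delta> :: nat \<Rightarrow> real).
          (\<forall>m. closed (A m) \<and> A m \<subseteq> K) \<and>
          (\<forall>m. \<delta> m > 0) \<and>
          K = (\<Union>m. A m) \<and>
          \<delta> \<longlonglongrightarrow> 0 \<and>
          (\<forall>m. A m \<subseteq> A (Suc m)) \<and>
          (\<lambda>m. GV_bar n (\<delta> m) f (A m) K) \<longlonglongrightarrow> 0))"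

end

theory Submission
  imports Defs
begin

text \<open>
  Let \<open>K\<close> be the set of points of varying monotonicity, \<open>h x y\<close> the variation of exponent
  \<open>1 / (n - 1)\<close> of \<open>f\<close> on \<open>K \<inter> {x..y}\<close>, and \<open>p = (n - 1) / n\<close>.  The generalized variations are
  suprema of sums of \<open>h x y powr p\<close>.  Of \<open>K\<close> only \<open>K \<subseteq> {a..b}\<close> is used, and both classes assume that
  the variation on \<open>K\<close> is finite.

  Assume that \<open>f\<close> is \<open>SBVG\<close>.  For large \<open>m\<close>, a collection with endpoints in \<open>A m\<close> consists of
  intervals of length at most \<open>\<delta> m\<close>, whose sum is bounded by \<open>GV_bar\<close>, and of boundedly many longer
  ones, each contributing a bounded amount (\<open>GV_finite\<close>).  As the \<open>A m\<close> increase, those with large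
  \<open>m\<close> still cover \<open>K\<close>.

  Conversely, \<open>CBVG\<close> yields \<open>SBVG\<close> for finite unions of the given sets, once the finiteness of
  \<open>GV n f A K\<close> is known to imply that \<open>GV_bar n \<delta> f A K\<close> tends to \<open>0\<close> with \<open>\<delta>\<close>
  (\<open>GV_bar_tendsto_0\<close>).  The function \<open>h\<close> is monotone, subadditive, and uniformly small on short
  intervals.  The main point is \<open>small_sums\<close>: as \<open>p < 1\<close>, the boundedness of the sums of
  \<open>h x y powr p\<close> over intervals with endpoints in \<open>A\<close> forces these sums to be small as soon as all
  the \<open>h x y\<close> are small.  Finally, each interval with left endpoint in \<open>A\<close>, except the last one, is
  extended to the next such endpoint in the collection, and symmetrically for right endpoints
  (\<open>small_sums_touching\<close>).  Among the extended intervals only boundedly many have a large \<open>h\<close>, and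
  for these the smallness of \<open>h\<close> on the original intervals is used.
\<close>

section \<open>Subdividing collections of non-overlapping intervals\<close>

lemma nonoverlapping_iff:
  "nonoverlapping P \<longleftrightarrow> finite P \<and> (\<forall>q \<in> P. fst q < snd q) \<and>
     (\<forall>q \<in> P. \<forall>q' \<in> P. q = q' \<or> snd q \<le> fst q' \<or> snd q' \<le> fst q)"
proof -
  have disj: "disjnt {c<..<d} {c'<..<d'} \<longleftrightarrow> d \<le> c' \<or> d' \<le> c"
    if "c < d" "c' < d'" for c d c' d' :: real
  proof
    assume "disjnt {c<..<d} {c'<..<d'}"
    show "d \<le> c' \<or> d' \<le> c"
    proof (rule ccontr)
      assume "\<not> ?thesis"
      then have "max c c' < min d d'"
        using that by auto
      then obtain z where "max c c' < z" "z < min d d'"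
        using dense by blast
      then show False
        using \<open>disjnt _ _\<close> by (auto simp: disjnt_iff)
    qed
  qed (auto simp: disjnt_iff)
  have pair: "(q \<noteq> q' \<longrightarrow> disjnt {fst q<..<snd q} {fst q'<..<snd q'})
      \<longleftrightarrow> q = q' \<or> snd q \<le> fst q' \<or> snd q' \<le> fst q"
    if "fst q < snd q" "fst q' < snd q'" for q q' :: "real \<times> real"
    using disj[OF that] by blast
  show ?thesis
    unfolding nonoverlapping_def pairwise_def case_prod_unfold
    by (intro conj_cong refl ball_cong pair) auto
qed

lemma nonoverlapping_finite: "nonoverlapping P \<Longrightarrow> finite P"
  by (simp add: nonoverlapping_iff)

lemma nonoverlapping_less: "nonoverlapping P \<Longrightarrow> q \<in> P \<Longrightarrow> fst q < snd q"
  by (simp add: nonoverlapping_iff)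

lemma nonoverlapping_disj:
  "nonoverlapping P \<Longrightarrow> q \<in> P \<Longrightarrow> q' \<in> P \<Longrightarrow> q = q' \<or> snd q \<le> fst q' \<or> snd q' \<le> fst q"
  by (simp add: nonoverlapping_iff)

lemma nonoverlapping_subset: "nonoverlapping P \<Longrightarrow> Q \<subseteq> P \<Longrightarrow> nonoverlapping Q"
  unfolding nonoverlapping_iff by (blast intro: finite_subset)

lemma nonoverlapping_inj_on_fst:
  assumes "nonoverlapping P"
  shows "inj_on fst P"
proof (rule inj_onI)
  fix q q' assume q: "q \<in> P" "q' \<in> P" "fst q = fst q'"
  show "q = q'"
    using nonoverlapping_disj[OF assms q(1,2)] nonoverlapping_less[OF assms q(1)]
      nonoverlapping_less[OF assms q(2)] q(3) by linarith
qed

lemma nonoverlapping_inj_on_snd: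
  assumes "nonoverlapping P"
  shows "inj_on snd P"
proof (rule inj_onI)
  fix q q' assume q: "q \<in> P" "q' \<in> P" "snd q = snd q'"
  show "q = q'"
    using nonoverlapping_disj[OF assms q(1,2)] nonoverlapping_less[OF assms q(1)]
      nonoverlapping_less[OF assms q(2)] q(3) by linarith
qed

text \<open>The finite collections of non-overlapping intervals with endpoints in \<open>S\<close>.\<close>
definition collections :: "real set \<Rightarrow> (real \<times> real) set set" where
  "collections S = {P. nonoverlapping P \<and> (\<forall>(c, d) \<in> P. c \<in> S \<and> d \<in> S)}"

lemma collections_empty: "{} \<in> collections S"
  by (simp add: collections_def nonoverlapping_iff)

lemma collections_nonoverlapping: "P \<in> collections S \<Longrightarrow> nonoverlapping P"
  by (simp add: collections_def)

lemma collections_finite: "P \<in> collections S \<Longrightarrow> finite P"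
  by (simp add: collections_def nonoverlapping_finite)

lemma collections_mem: "P \<in> collections S \<Longrightarrow> (c, d) \<in> P \<Longrightarrow> c \<in> S \<and> d \<in> S \<and> c < d"
  by (auto simp: collections_def dest: nonoverlapping_less)

lemma collections_Un:
  assumes "P \<in> collections S" "Q \<in> collections S"
    and "\<And>q q'. q \<in> P \<Longrightarrow> q' \<in> Q \<Longrightarrow> snd q \<le> fst q' \<or> snd q' \<le> fst q"
  shows "P \<union> Q \<in> collections S"
  using assms unfolding collections_def nonoverlapping_iff by (simp add: ball_Un) blast

lemma collections_subset: "P \<in> collections S \<Longrightarrow> Q \<subseteq> P \<Longrightarrow> Q \<in> collections S"
  by (auto simp: collections_def intro: nonoverlapping_subset)

lemma collections_mono: "P \<in> collections S \<Longrightarrow> S \<subseteq> T \<Longrightarrow> P \<in> collections T"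
  by (auto simp: collections_def)

definition endpoints :: "(real \<times> real) set \<Rightarrow> real set" where
  "endpoints P = fst ` P \<union> snd ` P"

lemma finite_endpoints: "finite P \<Longrightarrow> finite (endpoints P)"
  by (simp add: endpoints_def)

lemma endpoints_subset: "P \<in> collections S \<Longrightarrow> endpoints P \<subseteq> S"
  by (auto simp: endpoints_def collections_def)

lemma collections_endpoints:
  "P \<in> collections S \<Longrightarrow> endpoints P \<subseteq> X \<Longrightarrow> P \<in> collections X"
  by (force simp: endpoints_def collections_def)

text \<open>The intervals between neighbouring points of \<open>X\<close>.\<close>
definition elementary :: "real set \<Rightarrow> (real \<times> real) set" where
  "elementary X = {(x, y). x \<in> X \<and> y \<in> X \<and> x < y \<and> (\<forall>z \<in> X. z \<le> x \<or> y \<le> z)}"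

lemma elementary_collection:
  assumes "finite X" "X \<subseteq> S"
  shows "elementary X \<in> collections S"
proof -
  have "elementary X \<subseteq> X \<times> X"
    by (auto simp: elementary_def)
  then have "finite (elementary X)"
    using assms(1) finite_subset by blast
  then show ?thesis
    using assms(2) by (force simp: collections_def nonoverlapping_iff elementary_def)
qed

lemma finite_elementary: "finite X \<Longrightarrow> finite (elementary X)"
  using elementary_collection collections_finite by blast

lemma card_elementary_le:
  assumes "finite X"
  shows "card (elementary X) \<le> card X"
proof (rule card_inj_on_le)
  show "inj_on fst (elementary X)"
    using assms elementary_collection collections_nonoverlapping nonoverlapping_inj_on_fst by blast
  show "fst ` elementary X \<subseteq> X"
    by (auto simp: elementary_def)
qed (use assms in auto)

lemma elementary_successor:
  assumes "finite X" "x \<in> X" "z \<in> X" "x < z"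
  obtains y where "(x, y) \<in> elementary X"
proof -
  let ?Y = "{y \<in> X. x < y}"
  have Y: "finite ?Y" "?Y \<noteq> {}"
    using assms by auto
  then have "Min ?Y \<in> ?Y"
    by (rule Min_in)
  moreover have "z \<le> x \<or> Min ?Y \<le> z" if "z \<in> X" for z
    using that Y by (cases "x < z") auto
  ultimately have "(x, Min ?Y) \<in> elementary X"
    using assms by (auto simp: elementary_def)
  then show thesis
    using that by blast
qed

lemma elementary_predecessor:
  assumes "finite X" "y \<in> X" "z \<in> X" "z < y"
  obtains x where "(x, y) \<in> elementary X"
proof -
  let ?Y = "{x \<in> X. x < y}"
  have Y: "finite ?Y" "?Y \<noteq> {}"
    using assms by auto
  then have "Max ?Y \<in> ?Y"
    by (rule Max_in)
  moreover have "z \<le> Max ?Y \<or> y \<le> z" if "z \<in> X" for z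
    using that Y by (cases "z < y") auto
  ultimately have "(Max ?Y, y) \<in> elementary X"
    using assms by (auto simp: elementary_def)
  then show thesis
    using that by blast
qed

text \<open>Subadditivity of an interval function under splitting an interval at a point of \<open>S\<close>.\<close>
definition subadditive_on :: "real set \<Rightarrow> (real \<Rightarrow> real \<Rightarrow> real) \<Rightarrow> bool" where
  "subadditive_on S g \<longleftrightarrow>
     (\<forall>x \<in> S. \<forall>y \<in> S. \<forall>z \<in> S. x < y \<longrightarrow> y < z \<longrightarrow> g x z \<le> g x y + g y z)"

lemma subadditive_on_subset: "subadditive_on S g \<Longrightarrow> T \<subseteq> S \<Longrightarrow> subadditive_on T g"
  unfolding subadditive_on_def by blast

lemma subadditive_le_sum_elementary:
  assumes "subadditive_on X g" "finite X" "c \<in> X" "d \<in> X" "c < d"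
  shows "g c d \<le> (\<Sum>(x, y) \<in> {e \<in> elementary X. c \<le> fst e \<and> snd e \<le> d}. g x y)"
  using assms(3-5)
proof (induction "card (X \<inter> {c..d})" arbitrary: c d rule: less_induct)
  case less
  let ?E = "\<lambda>c d. {e \<in> elementary X. c \<le> fst e \<and> snd e \<le> d}"
  show ?case
  proof (cases "\<exists>z\<in>X. c < z \<and> z < d")
    case False
    then have "(c, d) \<in> elementary X"
      using less.prems by (force simp: elementary_def)
    moreover have "e = (c, d)" if "e \<in> ?E c d" for e
    proof -
      obtain x y where e: "e = (x, y)" "x \<in> X" "y \<in> X" "x < y" "c \<le> x" "y \<le> d"
        using \<open>e \<in> ?E c d\<close> by (auto simp: elementary_def)
      then have "\<not> c < x" "\<not> y < d"
        using False by (auto dest: less_le_trans le_less_trans)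
      then show ?thesis
        using e by simp
    qed
    ultimately have "?E c d = {(c, d)}"
      by auto
    then show ?thesis by simp
  next
    case True
    then obtain z where z: "z \<in> X" "c < z" "z < d" by blast
    have "X \<inter> {c..z} \<subset> X \<inter> {c..d}" "X \<inter> {z..d} \<subset> X \<inter> {c..d}"
      using z less.prems by (auto intro!: psubsetI dest!: equalityD2 dest: subsetD)
    then have "card (X \<inter> {c..z}) < card (X \<inter> {c..d})" "card (X \<inter> {z..d}) < card (X \<inter> {c..d})"
      using assms(2) by (auto intro: psubset_card_mono)
    then have IH: "g c z \<le> (\<Sum>(x, y) \<in> ?E c z. g x y)" "g z d \<le> (\<Sum>(x, y) \<in> ?E z d. g x y)"
      using z less.prems by (auto intro!: less.hyps)
    have un: "?E c d = ?E c z \<union> ?E z d"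
      using z by (force simp: elementary_def)
    have "?E c z \<inter> ?E z d = {}"
      by (force simp: elementary_def)
    then have "(\<Sum>(x, y) \<in> ?E c d. g x y) = (\<Sum>(x, y) \<in> ?E c z. g x y) + (\<Sum>(x, y) \<in> ?E z d. g x y)"
      unfolding un using finite_elementary[OF assms(2)] by (intro sum.union_disjoint) auto
    moreover have "g c d \<le> g c z + g z d"
      using assms(1) z less.prems unfolding subadditive_on_def by blast
    ultimately show ?thesis using IH by simp
  qed
qed

text \<open>The members of \<open>E\<close> that are contained in some member of \<open>Q\<close>.\<close>
definition inside_of :: "(real \<times> real) set \<Rightarrow> (real \<times> real) set \<Rightarrow> (real \<times> real) set" where
  "inside_of Q E = {e \<in> E. \<exists>q \<in> Q. fst q \<le> fst e \<and> snd e \<le> snd q}"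

lemma inside_of_subset: "inside_of Q E \<subseteq> E"
  by (auto simp: inside_of_def)

lemma sum_inside_of:
  fixes w :: "real \<times> real \<Rightarrow> real"
  assumes "finite X" "nonoverlapping Q"
  shows "(\<Sum>q\<in>Q. \<Sum>e\<in>{e \<in> elementary X. fst q \<le> fst e \<and> snd e \<le> snd q}. w e)
    = (\<Sum>e \<in> inside_of Q (elementary X). w e)"
proof -
  let ?E = "\<lambda>q. {e \<in> elementary X. fst q \<le> fst e \<and> snd e \<le> snd q}"
  have un: "inside_of Q (elementary X) = (\<Union>q\<in>Q. ?E q)"
    by (auto simp: inside_of_def)
  have disj: "?E q \<inter> ?E q' = {}" if "q \<in> Q" "q' \<in> Q" "q \<noteq> q'" for q q'
  proof -
    have "snd q \<le> fst q' \<or> snd q' \<le> fst q"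
      using nonoverlapping_disj[OF assms(2)] that by blast
    then show ?thesis
      by (force simp: elementary_def)
  qed
  show ?thesis
    unfolding un using finite_elementary[OF assms(1)] nonoverlapping_finite[OF assms(2)] disj
    by (intro sum.UNION_disjoint[symmetric]) auto
qed

text \<open>The sum of a subadditive function does not decrease when the intervals are subdivided.\<close>
lemma sum_le_sum_elementary:
  assumes "subadditive_on X g" "finite X" "Q \<in> collections X"
  shows "(\<Sum>(x, y) \<in> Q. g x y) \<le> (\<Sum>(x, y) \<in> inside_of Q (elementary X). g x y)"
proof -
  let ?E = "\<lambda>q. {e \<in> elementary X. fst q \<le> fst e \<and> snd e \<le> snd q}"
  have "(\<Sum>(x, y) \<in> Q. g x y) \<le> (\<Sum>q\<in>Q. \<Sum>(x, y)\<in>?E q. g x y)"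
  proof (intro sum_mono)
    fix q assume "q \<in> Q"
    obtain c d where q: "q = (c, d)" by (cases q)
    show "(case q of (x, y) \<Rightarrow> g x y) \<le> (\<Sum>(x, y)\<in>?E q. g x y)"
      using subadditive_le_sum_elementary[OF assms(1,2), of c d]
        collections_mem[OF assms(3), of c d] \<open>q \<in> Q\<close> q by auto
  qed
  also have "\<dots> = (\<Sum>(x, y) \<in> inside_of Q (elementary X). g x y)"
    using assms by (intro sum_inside_of collections_nonoverlapping)
  finally show ?thesis .
qed

lemma powr_subadditive:
  fixes u v p :: real
  assumes "0 \<le> u" "0 \<le> v" "0 < p" "p \<le> 1"
  shows "(u + v) powr p \<le> u powr p + v powr p"
proof (cases "u + v = 0")
  case True
  then show ?thesis using assms by (simp add: add_nonneg_eq_0_iff)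
next
  case False
  then have s: "u + v > 0" using assms by auto
  have *: "t \<le> t powr p" if "0 \<le> t" "t \<le> 1" for t :: real
    using powr_mono'[OF assms(4) that] that by (cases "t = 0") auto
  have "1 = u / (u + v) + v / (u + v)"
    using s by (simp flip: add_divide_distrib)
  also have "\<dots> \<le> (u / (u + v)) powr p + (v / (u + v)) powr p"
    using s assms by (intro add_mono *) (auto simp: divide_simps)
  also have "\<dots> = (u powr p + v powr p) / (u + v) powr p"
    using s assms by (simp add: powr_divide add_divide_distrib)
  finally show ?thesis
    using s by (simp add: field_simps)
qed

lemma subadditive_on_powr:
  assumes "subadditive_on S g" "0 < p" "p \<le> 1"
    and "\<And>x y. 0 \<le> g x y"
  shows "subadditive_on S (\<lambda>x y. g x y powr p)"
  unfolding subadditive_on_def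
proof (intro ballI impI)
  fix x y z assume "x \<in> S" "y \<in> S" "z \<in> S" "x < y" "y < z"
  then have "g x z powr p \<le> (g x y + g y z) powr p"
    using assms unfolding subadditive_on_def by (intro powr_mono2) auto
  also have "\<dots> \<le> g x y powr p + g y z powr p"
    using assms by (intro powr_subadditive)
  finally show "g x z powr p \<le> g x y powr p + g y z powr p" .
qed

section \<open>Sums over small intervals\<close>

text \<open>
  If the sums of \<open>h powr p\<close>, \<open>p < 1\<close>, over intervals with endpoints in \<open>A\<close> are bounded, then they
  tend to \<open>0\<close> as the values of \<open>h\<close> on the intervals tend to \<open>0\<close>.  Subdivide a nearly optimal \<open>P\<close> by
  the endpoints of a collection \<open>Q\<close> with \<open>h \<le> \<eta>\<close>.  The pieces in \<open>Q\<close> have total \<open>h\<close>-value at most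
  \<open>\<eta> powr (1 - p) * G\<close>, hence the remaining pieces already account for nearly the whole supremum, and
  little is left for \<open>Q\<close>.
\<close>
lemma small_sums:
  fixes h :: "real \<Rightarrow> real \<Rightarrow> real" and p G \<epsilon> :: real
  assumes sub: "subadditive_on A h" and nn: "\<And>x y. 0 \<le> h x y"
    and mono: "\<And>x u v y. \<lbrakk>x \<in> A; u \<in> A; v \<in> A; y \<in> A; x \<le> u; u < v; v \<le> y\<rbrakk> \<Longrightarrow> h u v \<le> h x y"
    and p: "0 < p" "p < 1"
    and bd: "\<And>P. P \<in> collections A \<Longrightarrow> (\<Sum>(x, y) \<in> P. h x y powr p) \<le> G"
    and "\<epsilon> > 0"
  obtains \<eta> where "\<eta> > 0"
    "\<And>Q. \<lbrakk>Q \<in> collections A; \<And>x y. (x, y) \<in> Q \<Longrightarrow> h x y \<le> \<eta>\<rbrakk>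
       \<Longrightarrow> (\<Sum>(x, y) \<in> Q. h x y powr p) \<le> \<epsilon>"
proof -
  define \<sigma> where "\<sigma> P = (\<Sum>(x, y) \<in> P. h x y powr p)" for P
  define s where "s = Sup (\<sigma> ` collections A)"
  have bdd: "bdd_above (\<sigma> ` collections A)"
    using bd by (auto simp: \<sigma>_def bdd_above_def)
  have le_s: "\<sigma> P \<le> s" if "P \<in> collections A" for P
    unfolding s_def using bdd that by (auto intro: cSup_upper)
  have "\<exists>v \<in> \<sigma> ` collections A. s - \<epsilon> / 2 < v"
    using less_cSupD[of "\<sigma> ` collections A" "s - \<epsilon> / 2"] collections_empty \<open>\<epsilon> > 0\<close>
    unfolding s_def by auto
  then obtain P where P: "P \<in> collections A" "s - \<epsilon> / 2 < \<sigma> P"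
    by auto
  define N where "N = real (card P)"
  define H where "H = max G 1"
  have H: "H > 0" "G \<le> H"
    by (auto simp: H_def)
  define t where "t = \<epsilon> / (2 * (N + 1))"
  have t: "t > 0" "N * t \<le> \<epsilon> / 2"
    using \<open>\<epsilon> > 0\<close> by (auto simp: t_def N_def field_simps add_pos_nonneg)
  \<comment> \<open>Chosen so that a total \<open>h\<close>-value of at most \<open>\<eta> powr (1 - p) * H\<close> has \<open>p\<close>-th power at most \<open>t\<close>.\<close>
  define \<eta> where "\<eta> = (t powr (1 / p) / H) powr (1 / (1 - p))"
  have "\<eta> > 0"
    using t H by (simp add: \<eta>_def)
  have \<eta>: "(\<eta> powr (1 - p) * H) powr p = t"
    using t H p by (simp add: \<eta>_def powr_powr)
  have "\<sigma> Q \<le> \<epsilon>"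
    if Q: "Q \<in> collections A" and small: "\<And>x y. (x, y) \<in> Q \<Longrightarrow> h x y \<le> \<eta>" for Q
  proof -
    define X where "X = endpoints P \<union> endpoints Q"
    have X: "finite X" "X \<subseteq> A"
      using P Q collections_finite finite_endpoints endpoints_subset unfolding X_def by blast+
    have QX: "Q \<in> collections X" and PX: "P \<in> collections X"
      using P Q collections_endpoints unfolding X_def by blast+
    define E where "E = elementary X"
    define EQ where "EQ = inside_of Q E"
    have EA: "E \<in> collections A" and EX: "E \<in> collections X"
      using X elementary_collection unfolding E_def by blast+
    have "EQ \<subseteq> E" "finite E"
      using X finite_elementary by (auto simp: EQ_def E_def inside_of_subset)
    then have EQA: "EQ \<in> collections A" "finite EQ"
      using EA collections_subset finite_subset by blast+
    have subX: "subadditive_on X h"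
      using sub X subadditive_on_subset by blast
    have subp: "subadditive_on X (\<lambda>x y. h x y powr p)"
      using p nn subX by (intro subadditive_on_powr) auto
    have Q_le: "\<sigma> Q \<le> \<sigma> EQ"
      unfolding \<sigma>_def EQ_def E_def using subp X QX by (intro sum_le_sum_elementary)
    have hEQ: "h x y \<le> \<eta>" if xy: "(x, y) \<in> EQ" for x y
    proof -
      obtain c d where "(c, d) \<in> Q" "c \<le> x" "y \<le> d"
        using xy by (auto simp: EQ_def inside_of_def)
      moreover have "x \<in> A" "y \<in> A" "x < y"
        using collections_mem[OF EQA(1) xy] by auto
      ultimately have "h x y \<le> h c d"
        using collections_mem[OF Q] by (intro mono) auto
      then show ?thesis
        using small[OF \<open>(c, d) \<in> Q\<close>] by simp
    qed
    have "(\<Sum>(x, y)\<in>EQ. h x y) \<le> (\<Sum>(x, y)\<in>EQ. \<eta> powr (1 - p) * h x y powr p)"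
    proof (intro sum_mono, clarify)
      fix x y assume "(x, y) \<in> EQ"
      have "h x y = h x y powr (1 - p) * h x y powr p"
        using nn[of x y] by (cases "h x y = 0") (auto simp flip: powr_add)
      also have "\<dots> \<le> \<eta> powr (1 - p) * h x y powr p"
        using p nn hEQ[OF \<open>(x, y) \<in> EQ\<close>] by (intro mult_right_mono powr_mono2) auto
      finally show "h x y \<le> \<eta> powr (1 - p) * h x y powr p" .
    qed
    also have "\<dots> = \<eta> powr (1 - p) * \<sigma> EQ"
      by (simp add: \<sigma>_def sum_distrib_left case_prod_unfold)
    also have "\<dots> \<le> \<eta> powr (1 - p) * H"
      using bd[OF EQA(1)] H by (intro mult_left_mono) (auto simp: \<sigma>_def)
    finally have "(\<Sum>(x, y)\<in>EQ. h x y) powr p \<le> (\<eta> powr (1 - p) * H) powr p"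
      using p nn by (intro powr_mono2) (auto intro!: sum_nonneg)
    then have EQ_le: "(\<Sum>(x, y)\<in>EQ. h x y) powr p \<le> t"
      using \<eta> by simp
    \<comment> \<open>The summand of the pieces outside \<open>Q\<close>; the pieces in \<open>Q\<close> are accounted for by \<open>t\<close>.\<close>
    define w where "w e = (if e \<in> EQ then 0 else h (fst e) (snd e) powr p)" for e
    have w_nn: "0 \<le> w e" for e
      by (auto simp: w_def)
    let ?E = "\<lambda>q. {e \<in> E. fst q \<le> fst e \<and> snd e \<le> snd q}"
    have piece: "h c d powr p \<le> t + (\<Sum>e\<in>?E (c, d). w e)" if "(c, d) \<in> P" for c d
    proof -
      let ?h = "\<lambda>e. h (fst e) (snd e)"
      have fin: "finite (?E (c, d))"
        using \<open>finite E\<close> by auto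
      have "h c d \<le> (\<Sum>e\<in>?E (c, d). ?h e)"
        using subadditive_le_sum_elementary[OF subX X(1), of c d] collections_mem[OF PX that]
        by (simp add: E_def case_prod_unfold)
      also have "\<dots> = (\<Sum>e\<in>?E (c, d) \<inter> EQ. ?h e) + (\<Sum>e\<in>?E (c, d) - EQ. ?h e)"
        using fin by (rule sum.Int_Diff)
      finally have "h c d powr p
          \<le> ((\<Sum>e\<in>?E (c, d) \<inter> EQ. ?h e) + (\<Sum>e\<in>?E (c, d) - EQ. ?h e)) powr p"
        using p nn by (intro powr_mono2) auto
      also have "\<dots> \<le> (\<Sum>e\<in>?E (c, d) \<inter> EQ. ?h e) powr p + (\<Sum>e\<in>?E (c, d) - EQ. ?h e) powr p"
        using p nn by (intro powr_subadditive sum_nonneg) auto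
      also have "(\<Sum>e\<in>?E (c, d) \<inter> EQ. ?h e) powr p \<le> (\<Sum>e\<in>EQ. ?h e) powr p"
        using p nn EQA by (intro powr_mono2 sum_mono2 sum_nonneg) auto
      also have "\<dots> \<le> t"
        using EQ_le by (simp add: case_prod_unfold)
      also have "(\<Sum>e\<in>?E (c, d) - EQ. ?h e) powr p \<le> (\<Sum>e\<in>?E (c, d) - EQ. ?h e powr p)"
        using fin p nn
      proof (induction rule: finite_induct[OF finite_Diff[OF fin, of EQ]])
        case (2 x F)
        have "(?h x + sum ?h F) powr p \<le> ?h x powr p + sum ?h F powr p"
          using p nn by (intro powr_subadditive sum_nonneg) auto
        then show ?case using 2 by simp
      qed auto
      also have "\<dots> = (\<Sum>e\<in>?E (c, d). w e)"
        using fin by (intro sum.mono_neutral_cong_left) (auto simp: w_def)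
      finally show ?thesis by simp
    qed
    have "\<sigma> P \<le> (\<Sum>q\<in>P. t + (\<Sum>e\<in>?E q. w e))"
      unfolding \<sigma>_def using piece by (intro sum_mono) auto
    also have "\<dots> = N * t + (\<Sum>e\<in>inside_of P E. w e)"
      using sum_inside_of[OF X(1) collections_nonoverlapping[OF P(1)], of w]
      by (simp add: sum.distrib N_def E_def)
    also have "(\<Sum>e\<in>inside_of P E. w e) \<le> (\<Sum>e\<in>E. w e)"
      using \<open>finite E\<close> w_nn by (intro sum_mono2 inside_of_subset)
    also have "(\<Sum>e\<in>E. w e) = \<sigma> E - \<sigma> EQ"
    proof -
      have "\<sigma> E - \<sigma> EQ = (\<Sum>(x, y)\<in>E - EQ. h x y powr p)"
        unfolding \<sigma>_def using \<open>finite E\<close> \<open>EQ \<subseteq> E\<close> by (simp add: sum_diff)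
      also have "\<dots> = (\<Sum>e\<in>E. w e)"
        using \<open>finite E\<close>
        by (intro sum.mono_neutral_cong_left) (auto simp: w_def split: prod.splits)
      finally show ?thesis by simp
    qed
    finally have "\<sigma> P \<le> N * t + (\<sigma> E - \<sigma> EQ)"
      by simp
    then show ?thesis
      using Q_le P(2) le_s[OF EA] t by simp
  qed
  then show thesis
    using that \<open>\<eta> > 0\<close> unfolding \<sigma>_def by blast
qed

text \<open>
  Truncating the values of \<open>h\<close> at a small height \<open>\<omega>\<close> makes all the sums small: the intervals with
  \<open>h \<le> \<eta>\<close> contribute little, and there are at most \<open>G / \<eta> powr p\<close> others.
\<close>
lemma small_truncated_sums:
  fixes h :: "real \<Rightarrow> real \<Rightarrow> real" and p G \<epsilon> :: real
  assumes sub: "subadditive_on A h" and nn: "\<And>x y. 0 \<le> h x y"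
    and mono: "\<And>x u v y. \<lbrakk>x \<in> A; u \<in> A; v \<in> A; y \<in> A; x \<le> u; u < v; v \<le> y\<rbrakk> \<Longrightarrow> h u v \<le> h x y"
    and p: "0 < p" "p < 1"
    and bd: "\<And>P. P \<in> collections A \<Longrightarrow> (\<Sum>(x, y) \<in> P. h x y powr p) \<le> G"
    and "\<epsilon> > 0"
  obtains \<omega> where "\<omega> > 0" "\<omega> powr p \<le> \<epsilon>"
    "\<And>E. E \<in> collections A \<Longrightarrow> (\<Sum>(x, y) \<in> E. min (h x y) \<omega> powr p) \<le> \<epsilon>"
proof -
  have "\<epsilon> / 2 > 0" using \<open>\<epsilon> > 0\<close> by simp
  obtain \<eta> where \<eta>: "\<eta> > 0"
    "\<And>Q. \<lbrakk>Q \<in> collections A; \<And>x y. (x, y) \<in> Q \<Longrightarrow> h x y \<le> \<eta>\<rbrakk>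
       \<Longrightarrow> (\<Sum>(x, y) \<in> Q. h x y powr p) \<le> \<epsilon> / 2"
    using small_sums[OF sub nn mono p bd \<open>\<epsilon> / 2 > 0\<close>] by blast
  define H where "H = max G 0"
  define D where "D = H / \<eta> powr p + 1"
  define t where "t = \<epsilon> / 2 / D"
  have "H \<ge> 0" by (simp add: H_def)
  have D: "D > 0"
    using \<open>H \<ge> 0\<close> unfolding D_def by (intro add_nonneg_pos) auto
  have t: "t > 0" "t * (H / \<eta> powr p) \<le> \<epsilon> / 2" "t \<le> \<epsilon>"
  proof -
    show "t > 0" using D \<open>\<epsilon> > 0\<close> by (simp add: t_def)
    have "t * D = \<epsilon> / 2"
      using D by (simp add: t_def)
    moreover have "t * (H / \<eta> powr p) \<ge> 0"
      using \<open>t > 0\<close> \<open>H \<ge> 0\<close> by simp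
    ultimately show "t * (H / \<eta> powr p) \<le> \<epsilon> / 2" "t \<le> \<epsilon>"
      using \<open>t > 0\<close> \<open>\<epsilon> > 0\<close> unfolding D_def distrib_left by linarith+
  qed
  define \<omega> where "\<omega> = t powr (1 / p)"
  have \<omega>: "\<omega> > 0" "\<omega> powr p = t"
    using t p by (auto simp: \<omega>_def powr_powr)
  have "(\<Sum>(x, y) \<in> E. min (h x y) \<omega> powr p) \<le> \<epsilon>" if E: "E \<in> collections A" for E
  proof -
    define B where "B = {e \<in> E. \<eta> < h (fst e) (snd e)}"
    have fin: "finite E" "finite B"
      using collections_finite[OF E] by (auto simp: B_def)
    have "real (card B) * \<eta> powr p = (\<Sum>e\<in>B. \<eta> powr p)"
      by simp
    also have "\<dots> \<le> (\<Sum>(x, y)\<in>B. h x y powr p)"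
      using \<open>\<eta> > 0\<close> p by (intro sum_mono) (auto simp: B_def intro!: powr_mono2)
    also have "\<dots> \<le> H"
      using bd[of B] collections_subset[OF E, of B] by (auto simp: B_def H_def)
    finally have card: "real (card B) \<le> H / \<eta> powr p"
      using \<open>\<eta> > 0\<close> by (simp add: field_simps)
    have "(\<Sum>(x, y) \<in> B. min (h x y) \<omega> powr p) \<le> (\<Sum>e\<in>B. t)"
      unfolding \<omega>(2)[symmetric] using p \<omega> nn by (intro sum_mono) (auto intro!: powr_mono2)
    also have "\<dots> = real (card B) * t"
      by simp
    also have "\<dots> \<le> H / \<eta> powr p * t"
      using t by (intro mult_right_mono card) simp
    also have "\<dots> \<le> \<epsilon> / 2"
      using t(2) by (simp add: mult.commute)
    finally have 1: "(\<Sum>(x, y) \<in> B. min (h x y) \<omega> powr p) \<le> \<epsilon> / 2" .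
    have "(\<Sum>(x, y) \<in> E - B. min (h x y) \<omega> powr p) \<le> (\<Sum>(x, y) \<in> E - B. h x y powr p)"
      using p \<omega> nn by (intro sum_mono) (auto intro!: powr_mono2)
    also have "\<dots> \<le> \<epsilon> / 2"
      using collections_subset[OF E, of "E - B"] by (intro \<eta>) (auto simp: B_def)
    finally have 2: "(\<Sum>(x, y) \<in> E - B. min (h x y) \<omega> powr p) \<le> \<epsilon> / 2" .
    have "(\<Sum>(x, y) \<in> E. min (h x y) \<omega> powr p)
      = (\<Sum>(x, y) \<in> E - B. min (h x y) \<omega> powr p) + (\<Sum>(x, y) \<in> B. min (h x y) \<omega> powr p)"
      using fin by (intro sum.subset_diff) (auto simp: B_def)
    then show ?thesis using 1 2 by simp
  qed
  then show thesis
    using that \<omega> t(3) by blast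
qed

text \<open>
  An interval with left endpoint in \<open>A\<close> is contained in the interval from this endpoint to the next
  left endpoint in the collection; the latter has both endpoints in \<open>A\<close>.  Only the last interval has
  no successor.  Intervals with right endpoint in \<open>A\<close> are treated symmetrically.
\<close>
lemma small_sums_touching:
  fixes h :: "real \<Rightarrow> real \<Rightarrow> real" and p G \<epsilon> :: real
  assumes "A \<subseteq> K" and sub: "subadditive_on K h" and nn: "\<And>x y. 0 \<le> h x y"
    and mono: "\<And>x u v y. \<lbrakk>x \<in> K; u \<in> K; v \<in> K; y \<in> K; x \<le> u; u < v; v \<le> y\<rbrakk> \<Longrightarrow> h u v \<le> h x y"
    and small: "\<And>\<omega>. \<omega> > 0 \<Longrightarrow> \<exists>\<delta>>0. \<forall>x\<in>K. \<forall>y\<in>K. x < y \<longrightarrow> y - x \<le> \<delta> \<longrightarrow> h x y \<le> \<omega>"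
    and p: "0 < p" "p < 1"
    and bd: "\<And>P. P \<in> collections A \<Longrightarrow> (\<Sum>(x, y) \<in> P. h x y powr p) \<le> G"
    and "\<epsilon> > 0"
  shows "\<exists>\<delta>>0. \<forall>Q \<in> collections K. (\<forall>(x, y) \<in> Q. y - x \<le> \<delta> \<and> (x \<in> A \<or> y \<in> A))
       \<longrightarrow> (\<Sum>(x, y) \<in> Q. h x y powr p) \<le> \<epsilon>"
proof -
  have "\<epsilon> / 4 > 0" using \<open>\<epsilon> > 0\<close> by simp
  have subA: "subadditive_on A h"
    using sub \<open>A \<subseteq> K\<close> by (rule subadditive_on_subset)
  have monoA: "\<And>x u v y. \<lbrakk>x \<in> A; u \<in> A; v \<in> A; y \<in> A; x \<le> u; u < v; v \<le> y\<rbrakk> \<Longrightarrow> h u v \<le> h x y"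
    using mono \<open>A \<subseteq> K\<close> by blast
  obtain \<omega> where \<omega>: "\<omega> > 0" "\<omega> powr p \<le> \<epsilon> / 4"
    "\<And>E. E \<in> collections A \<Longrightarrow> (\<Sum>(x, y) \<in> E. min (h x y) \<omega> powr p) \<le> \<epsilon> / 4"
    using small_truncated_sums[OF subA nn monoA p bd \<open>\<epsilon> / 4 > 0\<close>] by blast
  obtain \<delta> where \<delta>: "\<delta> > 0" "\<And>x y. \<lbrakk>x \<in> K; y \<in> K; x < y; y - x \<le> \<delta>\<rbrakk> \<Longrightarrow> h x y \<le> \<omega>"
    using small[OF \<open>\<omega> > 0\<close>] by blast
  let ?H = "\<lambda>e. h (fst e) (snd e) powr p"
  let ?T = "\<lambda>e. min (h (fst e) (snd e)) \<omega> powr p"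
  \<comment> \<open>Each interval of \<open>R\<close> other than \<open>q0\<close> lies in an interval with endpoints in \<open>A\<close> of its own.\<close>
  have except_one: "sum ?H R \<le> \<epsilon> / 2"
    if R: "R \<in> collections K" "\<And>x y. (x, y) \<in> R \<Longrightarrow> y - x \<le> \<delta>" and "q0 \<in> R"
      and E: "E \<in> collections A"
      and cover: "\<forall>q \<in> R - {q0}. \<exists>e \<in> E. \<psi> e = q \<and> fst e \<le> fst q \<and> snd q \<le> snd e"
    for R q0 E and \<psi> :: "real \<times> real \<Rightarrow> real \<times> real"
  proof -
    have fin: "finite R" "finite E"
      using R(1) E collections_finite by auto
    have R_mem: "fst q \<in> K \<and> snd q \<in> K \<and> fst q < snd q" if "q \<in> R" for q
      using collections_mem[OF R(1), of "fst q" "snd q"] that by simp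
    have le_\<omega>: "h (fst q) (snd q) \<le> \<omega>" if "q \<in> R" for q
      using R_mem[OF that] R(2)[of "fst q" "snd q"] that by (intro \<delta>(2)) auto
    have "sum ?H (R - {q0}) \<le> sum ?T E"
    proof (rule sum_le_included[where i = \<psi>])
      show "\<forall>q\<in>R - {q0}. \<exists>e\<in>E. \<psi> e = q \<and> ?H q \<le> ?T e"
      proof
        fix q assume q: "q \<in> R - {q0}"
        then obtain e where e: "e \<in> E" "\<psi> e = q" "fst e \<le> fst q" "snd q \<le> snd e"
          using cover by blast
        have "fst e \<in> K" "snd e \<in> K"
          using collections_mem[OF E, of "fst e" "snd e"] e \<open>A \<subseteq> K\<close> by auto
        then have "h (fst q) (snd q) \<le> h (fst e) (snd e)"
          using e q R_mem[of q] by (intro mono) auto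
        then have "?H q \<le> ?T e"
          using p nn q le_\<omega>[of q] by (intro powr_mono2) auto
        then show "\<exists>e\<in>E. \<psi> e = q \<and> ?H q \<le> ?T e"
          using e by blast
      qed
    qed (use fin in auto)
    also have "\<dots> \<le> \<epsilon> / 4"
      using \<omega>(3)[OF E] by (simp add: case_prod_unfold)
    finally have "sum ?H (R - {q0}) \<le> \<epsilon> / 4" .
    moreover have "?H q0 \<le> \<omega> powr p"
      using p nn le_\<omega>[OF \<open>q0 \<in> R\<close>] by (intro powr_mono2) auto
    ultimately show ?thesis
      using \<omega>(2) sum.remove[OF fin(1) \<open>q0 \<in> R\<close>, of ?H] by simp
  qed
  have left: "sum ?H R \<le> \<epsilon> / 2"
    if R: "R \<in> collections K" "\<And>x y. (x, y) \<in> R \<Longrightarrow> y - x \<le> \<delta>" "fst ` R \<subseteq> A" for R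
  proof (cases "R = {}")
    case False
    define X where "X = fst ` R"
    have nov: "nonoverlapping R"
      using R(1) by (rule collections_nonoverlapping)
    then have inj: "inj_on fst R"
      by (rule nonoverlapping_inj_on_fst)
    have X: "finite X" "X \<noteq> {}"
      using False R(1) collections_finite by (auto simp: X_def)
    then have "Max X \<in> X" by (intro Max_in)
    then obtain q0 where q0: "q0 \<in> R" "fst q0 = Max X"
      by (auto simp: X_def)
    show ?thesis
    proof (rule except_one[OF R(1,2) \<open>q0 \<in> R\<close>])
      show "elementary X \<in> collections A"
        using X R(3) by (intro elementary_collection) (auto simp: X_def)
      show "\<forall>q\<in>R - {q0}. \<exists>e\<in>elementary X. inv_into R fst (fst e) = q \<and> fst e \<le> fst q \<and> snd q \<le> snd e"
      proof
        fix q assume q: "q \<in> R - {q0}"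
        have "fst q \<noteq> fst q0"
          using q inj \<open>q0 \<in> R\<close> by (auto dest: inj_onD)
        then have "fst q \<in> X" "fst q \<noteq> Max X"
          using q q0 by (auto simp: X_def)
        then have "fst q < Max X"
          using X by (simp add: less_le)
        then obtain y where y: "(fst q, y) \<in> elementary X"
          using elementary_successor X \<open>fst q \<in> X\<close> \<open>Max X \<in> X\<close> by blast
        then obtain q' where q': "q' \<in> R" "fst q' = y" "fst q < y"
          by (auto simp: elementary_def X_def)
        then have "q \<noteq> q'"
          by auto
        then have "snd q \<le> y"
          using nonoverlapping_disj[OF nov _ q'(1), of q] nonoverlapping_less[OF nov q'(1)] q q'(2,3)
          by auto
        moreover have "inv_into R fst (fst q) = q"
          using inj q by simp
        ultimately show "\<exists>e\<in>elementary X. inv_into R fst (fst e) = q \<and> fst e \<le> fst q \<and> snd q \<le> snd e"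
          using y by (intro bexI[of _ "(fst q, y)"]) auto
      qed
    qed
  qed (use \<open>\<epsilon> > 0\<close> in simp)
  have right: "sum ?H R \<le> \<epsilon> / 2"
    if R: "R \<in> collections K" "\<And>x y. (x, y) \<in> R \<Longrightarrow> y - x \<le> \<delta>" "snd ` R \<subseteq> A" for R
  proof (cases "R = {}")
    case False
    define X where "X = snd ` R"
    have nov: "nonoverlapping R"
      using R(1) by (rule collections_nonoverlapping)
    then have inj: "inj_on snd R"
      by (rule nonoverlapping_inj_on_snd)
    have X: "finite X" "X \<noteq> {}"
      using False R(1) collections_finite by (auto simp: X_def)
    then have "Min X \<in> X" by (intro Min_in)
    then obtain q0 where q0: "q0 \<in> R" "snd q0 = Min X"
      by (auto simp: X_def)
    show ?thesis
    proof (rule except_one[OF R(1,2) \<open>q0 \<in> R\<close>])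
      show "elementary X \<in> collections A"
        using X R(3) by (intro elementary_collection) (auto simp: X_def)
      show "\<forall>q\<in>R - {q0}. \<exists>e\<in>elementary X. inv_into R snd (snd e) = q \<and> fst e \<le> fst q \<and> snd q \<le> snd e"
      proof
        fix q assume q: "q \<in> R - {q0}"
        have "snd q \<noteq> snd q0"
          using q inj \<open>q0 \<in> R\<close> by (auto dest: inj_onD)
        then have "snd q \<in> X" "snd q \<noteq> Min X"
          using q q0 by (auto simp: X_def)
        then have "Min X < snd q"
          using X by (simp add: less_le)
        then obtain x where x: "(x, snd q) \<in> elementary X"
          using elementary_predecessor X \<open>snd q \<in> X\<close> \<open>Min X \<in> X\<close> by blast
        then obtain q' where q': "q' \<in> R" "snd q' = x" "x < snd q"
          by (auto simp: elementary_def X_def)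
        then have "q \<noteq> q'"
          by auto
        then have "x \<le> fst q"
          using nonoverlapping_disj[OF nov _ q'(1), of q] nonoverlapping_less[OF nov q'(1)] q q'(2,3)
          by auto
        moreover have "inv_into R snd (snd q) = q"
          using inj q by simp
        ultimately show "\<exists>e\<in>elementary X. inv_into R snd (snd e) = q \<and> fst e \<le> fst q \<and> snd q \<le> snd e"
          using x by (intro bexI[of _ "(x, snd q)"]) auto
      qed
    qed
  qed (use \<open>\<epsilon> > 0\<close> in simp)
  have "sum ?H Q \<le> \<epsilon>"
    if Q: "Q \<in> collections K" "\<forall>(x, y) \<in> Q. y - x \<le> \<delta> \<and> (x \<in> A \<or> y \<in> A)" for Q
  proof -
    define L where "L = {q \<in> Q. fst q \<in> A}"
    have sub: "L \<subseteq> Q" "Q - L \<subseteq> Q"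
      by (auto simp: L_def)
    have "sum ?H L \<le> \<epsilon> / 2"
      using Q sub(1) by (intro left collections_subset[OF Q(1)]) (auto simp: L_def)
    moreover have "sum ?H (Q - L) \<le> \<epsilon> / 2"
      using Q by (intro right collections_subset[OF Q(1)]) (auto simp: L_def)
    ultimately show ?thesis
      using sum.subset_diff[OF sub(1) collections_finite[OF Q(1)], of ?H] by simp
  qed
  then show ?thesis
    using \<open>\<delta> > 0\<close> by (intro exI[of _ \<delta>]) (auto simp: case_prod_unfold)
qed

section \<open>Fractional variation on subintervals\<close>

lemma frac_variation_eq:
  "frac_variation \<alpha> f S = (SUP P \<in> collections S. ennreal (\<Sum>(c, d) \<in> P. \<bar>f d - f c\<bar> powr \<alpha>))"
  unfolding frac_variation_def collections_def
  by (intro SUP_cong refl) (simp add: case_prod_unfold)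

lemma frac_variation_mono: "S \<subseteq> T \<Longrightarrow> frac_variation \<alpha> f S \<le> frac_variation \<alpha> f T"
  unfolding frac_variation_eq by (rule SUP_subset_mono) (auto intro: collections_mono)

lemma sum_le_frac_variation:
  assumes "frac_variation \<alpha> f S < \<infinity>" "P \<in> collections S"
  shows "(\<Sum>(c, d) \<in> P. \<bar>f d - f c\<bar> powr \<alpha>) \<le> enn2real (frac_variation \<alpha> f S)"
proof -
  have "ennreal (\<Sum>(c, d) \<in> P. \<bar>f d - f c\<bar> powr \<alpha>) \<le> frac_variation \<alpha> f S"
    unfolding frac_variation_eq using assms(2) by (rule SUP_upper)
  moreover have "0 \<le> (\<Sum>(c, d) \<in> P. \<bar>f d - f c\<bar> powr \<alpha>)"
    by (intro sum_nonneg) auto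
  ultimately show ?thesis
    using enn2real_mono assms(1) by fastforce
qed

lemma frac_variation_le:
  assumes "\<And>P. P \<in> collections S \<Longrightarrow> (\<Sum>(c, d) \<in> P. \<bar>f d - f c\<bar> powr \<alpha>) \<le> C"
  shows "enn2real (frac_variation \<alpha> f S) \<le> C"
proof (rule enn2real_leI)
  show "0 \<le> C"
    using assms[OF collections_empty] by simp
  show "frac_variation \<alpha> f S \<le> ennreal C"
    unfolding frac_variation_eq using assms by (intro SUP_least ennreal_leI)
qed

lemma subadditive_on_increment:
  fixes f :: "real \<Rightarrow> real"
  assumes "0 < \<alpha>" "\<alpha> \<le> 1"
  shows "subadditive_on S (\<lambda>c d. \<bar>f d - f c\<bar> powr \<alpha>)"
  using assms by (intro subadditive_on_powr) (auto simp: subadditive_on_def)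

text \<open>
  The variation on \<open>K \<inter> {x..y}\<close> as a real number.  The value is \<open>0\<close> where the variation is
  infinite, which is excluded below by assuming that the variation on \<open>K\<close> is finite.
\<close>
definition subvar :: "real \<Rightarrow> (real \<Rightarrow> real) \<Rightarrow> real set \<Rightarrow> real \<Rightarrow> real \<Rightarrow> real" where
  "subvar \<alpha> f K x y = enn2real (frac_variation \<alpha> f (K \<inter> {x..y}))"

lemma frac_variation_Int_finite:
  assumes "frac_variation \<alpha> f K < \<infinity>"
  shows "frac_variation \<alpha> f (K \<inter> S) < \<infinity>"
  using frac_variation_mono[of "K \<inter> S" K \<alpha> f] assms by (auto intro: le_less_trans)

lemma subvar_nonneg: "0 \<le> subvar \<alpha> f K x y"
  by (simp add: subvar_def)

lemma subvar_mono:
  assumes "frac_variation \<alpha> f K < \<infinity>" "x \<le> u" "v \<le> y"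
  shows "subvar \<alpha> f K u v \<le> subvar \<alpha> f K x y"
  unfolding subvar_def using assms frac_variation_Int_finite[OF assms(1)]
  by (intro enn2real_mono frac_variation_mono) auto

lemma subvar_le:
  assumes "frac_variation \<alpha> f K < \<infinity>"
  shows "subvar \<alpha> f K x y \<le> enn2real (frac_variation \<alpha> f K)"
  unfolding subvar_def using assms by (intro enn2real_mono frac_variation_mono) auto

lemma subadditive_on_subvar:
  assumes fin: "frac_variation \<alpha> f K < \<infinity>" and "0 < \<alpha>" "\<alpha> \<le> 1"
  shows "subadditive_on K (subvar \<alpha> f K)"
  unfolding subadditive_on_def
proof (intro ballI impI)
  fix x y z assume xyz: "x \<in> K" "y \<in> K" "z \<in> K" "x < y" "y < z"
  let ?\<sigma> = "\<lambda>P. \<Sum>(c, d) \<in> P. \<bar>f d - f c\<bar> powr \<alpha>"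
  have "?\<sigma> P \<le> subvar \<alpha> f K x y + subvar \<alpha> f K y z" if P: "P \<in> collections (K \<inter> {x..z})" for P
  proof -
    define X where "X = insert y (endpoints P)"
    have X: "finite X" "X \<subseteq> K \<inter> {x..z}"
      using endpoints_subset[OF P] finite_endpoints[OF collections_finite[OF P]] xyz
      by (auto simp: X_def)
    define E where "E = elementary X"
    define E1 where "E1 = {e \<in> E. snd e \<le> y}"
    have E: "E \<in> collections (K \<inter> {x..z})"
      unfolding E_def using X by (rule elementary_collection)
    note Em = collections_mem[OF E]
    have E1: "E1 \<in> collections (K \<inter> {x..y})"
      using collections_subset[OF E, of E1] Em by (force simp: E1_def collections_def)
    have "y \<le> c" if "(c, d) \<in> E - E1" for c d
      using that by (auto simp: E1_def E_def elementary_def X_def)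
    then have E2: "E - E1 \<in> collections (K \<inter> {y..z})"
      using collections_subset[OF E, of "E - E1"] Em by (force simp: collections_def)
    have "?\<sigma> P \<le> ?\<sigma> (inside_of P E)"
      unfolding E_def using assms(2,3) X(1) P
      by (intro sum_le_sum_elementary subadditive_on_increment)
        (auto simp: X_def intro: collections_endpoints)
    also have "\<dots> \<le> ?\<sigma> E"
      using collections_finite[OF E] by (intro sum_mono2 inside_of_subset) auto
    also have "\<dots> = ?\<sigma> (E - E1) + ?\<sigma> E1"
      using collections_finite[OF E] by (intro sum.subset_diff) (auto simp: E1_def)
    also have "\<dots> \<le> subvar \<alpha> f K y z + subvar \<alpha> f K x y"
      unfolding subvar_def using E1 E2 frac_variation_Int_finite[OF fin]
      by (intro add_mono sum_le_frac_variation)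
    finally show ?thesis by simp
  qed
  then show "subvar \<alpha> f K x z \<le> subvar \<alpha> f K x y + subvar \<alpha> f K y z"
    by (subst (1) subvar_def) (rule frac_variation_le)
qed

text \<open>
  Over short intervals the variation is uniformly small.  Let \<open>P\<close> be a nearly optimal collection in
  \<open>K\<close>, subdivided by the endpoints of a short interval \<open>[x, y]\<close>.  The boundedly many pieces inside
  \<open>[x, y]\<close> contribute little by uniform continuity, so the pieces outside are still nearly optimal
  and leave little room for the variation on \<open>[x, y]\<close>.
\<close>
lemma subvar_small:
  assumes fin: "frac_variation \<alpha> f K < \<infinity>" and \<alpha>: "0 < \<alpha>" "\<alpha> \<le> 1"
    and cont: "uniformly_continuous_on K f" and "\<omega> > 0"
  shows "\<exists>\<delta>>0. \<forall>x\<in>K. \<forall>y\<in>K. x < y \<longrightarrow> y - x \<le> \<delta> \<longrightarrow> subvar \<alpha> f K x y \<le> \<omega>"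
proof -
  define \<sigma> where "\<sigma> P = (\<Sum>(c, d) \<in> P. \<bar>f d - f c\<bar> powr \<alpha>)" for P
  define V where "V = enn2real (frac_variation \<alpha> f K)"
  have "\<exists>P \<in> collections K. V - \<omega> / 2 < \<sigma> P"
  proof (rule ccontr)
    assume "\<not> ?thesis"
    then have "V \<le> V - \<omega> / 2"
      unfolding V_def \<sigma>_def by (intro frac_variation_le) (auto simp: not_less)
    then show False using \<open>\<omega> > 0\<close> by simp
  qed
  then obtain P where P: "P \<in> collections K" "V - \<omega> / 2 < \<sigma> P" by blast
  \<comment> \<open>A bound for the number of elementary intervals of the endpoints of \<open>P\<close> together with \<open>x\<close> and \<open>y\<close>.\<close>
  define N where "N = real (card (endpoints P) + 2)"
  define \<tau> where "\<tau> = \<omega> / (2 * N)"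
  have N: "N > 0" by (simp add: N_def)
  have \<tau>: "\<tau> > 0" "N * \<tau> = \<omega> / 2"
    using N \<open>\<omega> > 0\<close> by (auto simp: \<tau>_def)
  have "\<tau> powr (1 / \<alpha>) > 0"
    using \<tau> by simp
  then obtain \<delta> where \<delta>: "\<delta> > 0"
    "\<And>u v. \<lbrakk>u \<in> K; v \<in> K; dist v u < \<delta>\<rbrakk> \<Longrightarrow> dist (f v) (f u) < \<tau> powr (1 / \<alpha>)"
    using cont unfolding uniformly_continuous_on_def by blast
  have "subvar \<alpha> f K x y \<le> \<omega>" if xy: "x \<in> K" "y \<in> K" "x < y" "y - x \<le> \<delta> / 2" for x y
    unfolding subvar_def
  proof (rule frac_variation_le)
    fix Q assume Q: "Q \<in> collections (K \<inter> {x..y})"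
    define X where "X = endpoints P \<union> {x, y}"
    have X: "finite X" "X \<subseteq> K"
      using endpoints_subset[OF P(1)] finite_endpoints[OF collections_finite[OF P(1)]] xy
      by (auto simp: X_def)
    define E where "E = elementary X"
    define F where "F = {e \<in> E. x \<le> fst e \<and> snd e \<le> y}"
    have E: "E \<in> collections K"
      unfolding E_def using X by (rule elementary_collection)
    have "\<sigma> P \<le> \<sigma> (inside_of P E)"
      unfolding E_def \<sigma>_def using \<alpha> X(1) P(1)
      by (intro sum_le_sum_elementary subadditive_on_increment)
        (auto simp: X_def intro: collections_endpoints)
    also have "\<dots> \<le> \<sigma> E"
      unfolding \<sigma>_def using collections_finite[OF E] by (intro sum_mono2 inside_of_subset) auto
    also have "\<dots> = \<sigma> (E - F) + \<sigma> F"
      unfolding \<sigma>_def using collections_finite[OF E]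
      by (intro sum.subset_diff) (auto simp: F_def)
    also have "\<sigma> F \<le> \<omega> / 2"
    proof -
      have "\<bar>f d - f c\<bar> powr \<alpha> \<le> \<tau>" if "(c, d) \<in> F" for c d
      proof -
        have "c \<in> K" "d \<in> K" "c < d" "x \<le> c" "d \<le> y"
          using that collections_mem[OF E, of c d] by (auto simp: F_def)
        then have "\<bar>f d - f c\<bar> \<le> \<tau> powr (1 / \<alpha>)"
          using \<delta>(2)[of c d] xy \<delta>(1) by (auto simp: dist_real_def)
        then have "\<bar>f d - f c\<bar> powr \<alpha> \<le> (\<tau> powr (1 / \<alpha>)) powr \<alpha>"
          using \<alpha> by (intro powr_mono2) auto
        then show ?thesis
          using \<alpha> \<tau> by (simp add: powr_powr)
      qed
      then have "\<sigma> F \<le> (\<Sum>e\<in>F. \<tau>)"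
        unfolding \<sigma>_def by (intro sum_mono) auto
      also have "\<dots> = real (card F) * \<tau>"
        by simp
      also have "\<dots> \<le> N * \<tau>"
      proof (intro mult_right_mono)
        have "card F \<le> card E"
          using collections_finite[OF E] by (intro card_mono) (auto simp: F_def)
        also have "\<dots> \<le> card X"
          unfolding E_def using X(1) by (rule card_elementary_le)
        also have "\<dots> \<le> card (endpoints P) + card {x, y}"
          unfolding X_def by (rule card_Un_le)
        also have "\<dots> \<le> card (endpoints P) + 2"
          using xy by simp
        finally show "real (card F) \<le> N"
          unfolding N_def by (rule of_nat_mono)
      qed (use \<tau> in simp)
      finally show ?thesis using \<tau>(2) by simp
    qed
    finally have P_le: "\<sigma> P \<le> \<sigma> (E - F) + \<omega> / 2" by simp
    have outside: "d \<le> x \<or> y \<le> c" if "(c, d) \<in> E - F" for c d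
      using that by (auto simp: F_def E_def X_def elementary_def)
    have Qm: "c \<in> K \<and> d \<in> K \<and> x \<le> c \<and> c < d \<and> d \<le> y" if "(c, d) \<in> Q" for c d
      using collections_mem[OF Q that] by auto
    have sep: "d \<le> c' \<or> d' \<le> c" if "(c, d) \<in> Q" "(c', d') \<in> E - F" for c d c' d'
      using outside[OF that(2)] Qm[OF that(1)] by auto
    have "Q \<union> (E - F) \<in> collections K"
      using collections_mono[OF Q, of K] collections_subset[OF E, of "E - F"] sep
      by (intro collections_Un) auto
    then have "\<sigma> (Q \<union> (E - F)) \<le> V"
      unfolding V_def \<sigma>_def using fin by (intro sum_le_frac_variation)
    moreover have "Q \<inter> (E - F) = {}"
      using sep Qm by fastforce
    then have "\<sigma> (Q \<union> (E - F)) = \<sigma> Q + \<sigma> (E - F)"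
      unfolding \<sigma>_def using collections_finite[OF Q] collections_finite[OF E]
      by (intro sum.union_disjoint) auto
    ultimately have "\<sigma> Q \<le> \<omega>"
      using P_le P(2) by simp
    then show "(\<Sum>(c, d) \<in> Q. \<bar>f d - f c\<bar> powr \<alpha>) \<le> \<omega>"
      by (simp add: \<sigma>_def)
  qed
  then show ?thesis
    using \<delta>(1) by (intro exI[of _ "\<delta> / 2"]) auto
qed

section \<open>Generalized variation\<close>

lemma gv_sum_eq:
  assumes "frac_variation (1 / (real n - 1)) f K < \<infinity>"
  shows "gv_sum n f K P =
    ennreal (\<Sum>(x, y) \<in> P. subvar (1 / (real n - 1)) f K x y powr ((real n - 1) / real n))"
  using frac_variation_Int_finite[OF assms]
  by (simp add: less_top[symmetric] gv_sum_def ennreal_pow_def subvar_def case_prod_unfold)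

lemma gv_sum_mono: "finite P \<Longrightarrow> Q \<subseteq> P \<Longrightarrow> gv_sum n f K Q \<le> gv_sum n f K P"
  unfolding gv_sum_def by (intro sum_mono2) auto

lemma gv_sum_Un_le:
  assumes "finite P" "P = Q \<union> R"
  shows "gv_sum n f K P \<le> gv_sum n f K Q + gv_sum n f K R"
proof -
  have "gv_sum n f K P = gv_sum n f K (P - Q) + gv_sum n f K Q"
    unfolding gv_sum_def using assms by (intro sum.subset_diff) auto
  also have "\<dots> \<le> gv_sum n f K R + gv_sum n f K Q"
    using assms by (intro add_mono gv_sum_mono) auto
  finally show ?thesis by (simp add: add.commute)
qed

lemma GV_eq: "GV n f A K = (SUP P \<in> collections A. gv_sum n f K P)"
  by (simp add: GV_def collections_def)

lemma GV_bar_eq: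
  "GV_bar n \<delta> f A K =
     (SUP P \<in> {P \<in> collections K. \<forall>(x, y) \<in> P. y - x \<le> \<delta> \<and> (x \<in> A \<or> y \<in> A)}. gv_sum n f K P)"
  unfolding GV_bar_def collections_def by (intro SUP_cong) (auto simp: case_prod_unfold)

lemma GV_bar_mono: "\<delta> \<le> \<delta>' \<Longrightarrow> GV_bar n \<delta> f A K \<le> GV_bar n \<delta>' f A K"
  unfolding GV_bar_eq by (intro SUP_subset_mono) force+

lemma GV_bar_empty: "GV_bar n \<delta> f {} K = 0"
proof -
  have "gv_sum n f K P = 0" if "\<forall>(x, y) \<in> P. y - x \<le> \<delta> \<and> (x \<in> {} \<or> y \<in> {})" for P
  proof -
    have "P = {}" using that by auto
    then show ?thesis by (simp add: gv_sum_def)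
  qed
  then have "GV_bar n \<delta> f {} K \<le> 0"
    unfolding GV_bar_eq by (intro SUP_least) (simp del: split_paired_All)
  then show ?thesis by simp
qed

lemma GV_bar_Un_le: "GV_bar n \<delta> f (A \<union> B) K \<le> GV_bar n \<delta> f A K + GV_bar n \<delta> f B K"
proof -
  let ?adm = "\<lambda>A. {P \<in> collections K. \<forall>(x, y) \<in> P. y - x \<le> \<delta> \<and> (x \<in> A \<or> y \<in> A)}"
  have "gv_sum n f K P \<le> GV_bar n \<delta> f A K + GV_bar n \<delta> f B K" if P: "P \<in> ?adm (A \<union> B)" for P
  proof -
    define PA where "PA = {q \<in> P. fst q \<in> A \<or> snd q \<in> A}"
    have "PA \<in> ?adm A" "P - PA \<in> ?adm B"
      using P by (auto simp: PA_def intro: collections_subset)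
    moreover have "gv_sum n f K P \<le> gv_sum n f K PA + gv_sum n f K (P - PA)"
      using P by (intro gv_sum_Un_le) (auto simp: PA_def intro: collections_finite)
    ultimately show ?thesis
      unfolding GV_bar_eq by (meson SUP_upper add_mono order_trans)
  qed
  then show ?thesis
    by (subst (1) GV_bar_eq) (rule SUP_least)
qed

lemma GV_bar_tendsto_0:
  assumes "n \<ge> 2" "A \<subseteq> K" and cont: "uniformly_continuous_on K f"
    and fin: "frac_variation (1 / (real n - 1)) f K < \<infinity>" and GV: "GV n f A K < \<infinity>"
  shows "((\<lambda>\<delta>. GV_bar n \<delta> f A K) \<longlongrightarrow> 0) (at_right 0)"
proof (rule order_tendstoI)
  fix z :: ennreal assume "0 < z"
  then obtain w where "0 < w" "w < z"
    using dense by blast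
  then obtain \<epsilon> where \<epsilon>: "\<epsilon> > 0" "ennreal \<epsilon> < z"
    by (cases w) auto
  define \<alpha> where "\<alpha> = 1 / (real n - 1)"
  define p where "p = (real n - 1) / real n"
  let ?h = "subvar \<alpha> f K"
  have \<alpha>: "0 < \<alpha>" "\<alpha> \<le> 1" and p: "0 < p" "p < 1"
    using assms(1) by (auto simp: \<alpha>_def p_def)
  have fin': "frac_variation \<alpha> f K < \<infinity>"
    using fin by (simp add: \<alpha>_def)
  have gv: "gv_sum n f K P = ennreal (\<Sum>(x, y) \<in> P. ?h x y powr p)" for P
    unfolding \<alpha>_def p_def using fin by (rule gv_sum_eq)
  have bd: "(\<Sum>(x, y) \<in> P. ?h x y powr p) \<le> enn2real (GV n f A K)" if "P \<in> collections A" for P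
  proof -
    have "ennreal (\<Sum>(x, y) \<in> P. ?h x y powr p) \<le> GV n f A K"
      unfolding GV_eq gv[symmetric] using that by (rule SUP_upper)
    moreover have "0 \<le> (\<Sum>(x, y) \<in> P. ?h x y powr p)"
      by (intro sum_nonneg) auto
    ultimately show ?thesis
      using enn2real_mono GV by fastforce
  qed
  have "\<exists>\<delta>>0. \<forall>Q \<in> collections K. (\<forall>(x, y) \<in> Q. y - x \<le> \<delta> \<and> (x \<in> A \<or> y \<in> A))
       \<longrightarrow> (\<Sum>(x, y) \<in> Q. ?h x y powr p) \<le> \<epsilon>"
    using \<alpha> fin' cont subvar_nonneg subvar_mono[OF fin']
    by (intro small_sums_touching[OF \<open>A \<subseteq> K\<close> subadditive_on_subvar _ _ subvar_small p bd \<epsilon>(1)])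
  then obtain \<delta> where \<delta>: "\<delta> > 0"
    "\<And>Q. Q \<in> collections K \<Longrightarrow> \<forall>(x, y) \<in> Q. y - x \<le> \<delta> \<and> (x \<in> A \<or> y \<in> A)
       \<Longrightarrow> (\<Sum>(x, y) \<in> Q. ?h x y powr p) \<le> \<epsilon>"
    by blast
  have le: "GV_bar n \<delta> f A K \<le> ennreal \<epsilon>"
    unfolding GV_bar_eq gv using \<delta>(2) by (intro SUP_least ennreal_leI) auto
  have "GV_bar n \<delta>' f A K < z" if "\<delta>' < \<delta>" for \<delta>'
    using le_less_trans[OF order_trans[OF GV_bar_mono le] \<epsilon>(2)] that by simp
  then show "\<forall>\<^sub>F \<delta> in at_right 0. GV_bar n \<delta> f A K < z"
    using \<delta>(1) by (auto simp: eventually_at_right_field)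
qed simp

lemma GV_bar_UN_tendsto_0:
  assumes "finite I" "\<And>i. i \<in> I \<Longrightarrow> ((\<lambda>\<delta>. GV_bar n \<delta> f (A i) K) \<longlongrightarrow> 0) (at_right 0)"
  shows "((\<lambda>\<delta>. GV_bar n \<delta> f (\<Union>i\<in>I. A i) K) \<longlongrightarrow> 0) (at_right 0)"
  using assms
proof (induction I rule: finite_induct)
  case (insert i I)
  have "((\<lambda>\<delta>. GV_bar n \<delta> f (A i) K + GV_bar n \<delta> f (\<Union>i\<in>I. A i) K) \<longlongrightarrow> 0 + 0) (at_right 0)"
    using insert by (intro tendsto_add) auto
  then have lim: "((\<lambda>\<delta>. GV_bar n \<delta> f (A i) K + GV_bar n \<delta> f (\<Union>i\<in>I. A i) K) \<longlongrightarrow> 0) (at_right 0)"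
    by simp
  have "GV_bar n \<delta> f (\<Union>i\<in>insert i I. A i) K
      \<le> GV_bar n \<delta> f (A i) K + GV_bar n \<delta> f (\<Union>i\<in>I. A i) K" for \<delta>
    by (simp add: GV_bar_Un_le)
  then show ?case
    by (intro tendsto_sandwich[OF _ _ tendsto_const lim] always_eventually allI) simp_all
qed (simp add: GV_bar_empty)

text \<open>
  Among non-overlapping intervals in \<open>[a, b]\<close> only boundedly many are longer than \<open>\<delta>\<close>: if \<open>x < x'\<close>
  are two of their left endpoints, then \<open>x' > x + \<delta>\<close>, so the integer parts of \<open>x / \<delta>\<close> and
  \<open>x' / \<delta>\<close> differ.
\<close>
lemma GV_finite:
  assumes "n \<ge> 2" "A \<subseteq> K" "K \<subseteq> {a..b}" "\<delta> > 0"
    and fin: "frac_variation (1 / (real n - 1)) f K < \<infinity>" and bar: "GV_bar n \<delta> f A K < \<infinity>"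
  shows "GV n f A K < \<infinity>"
proof -
  define \<alpha> where "\<alpha> = 1 / (real n - 1)"
  define p where "p = (real n - 1) / real n"
  have p: "0 \<le> p" using assms(1) by (simp add: p_def)
  have fin': "frac_variation \<alpha> f K < \<infinity>"
    using fin by (simp add: \<alpha>_def)
  define W where "W = enn2real (frac_variation \<alpha> f K) powr p"
  define Z where "Z = {\<lfloor>a / \<delta>\<rfloor>..\<lfloor>b / \<delta>\<rfloor>}"
  have "gv_sum n f K P \<le> GV_bar n \<delta> f A K + ennreal (real (card Z) * W)"
    if P: "P \<in> collections A" for P
  proof -
    define S where "S = {q \<in> P. snd q - fst q \<le> \<delta>}"
    define L where "L = P - S"
    have finP: "finite P" using P by (rule collections_finite)
    have S: "S \<in> collections A"
      using P by (rule collections_subset) (auto simp: S_def)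
    have "gv_sum n f K S \<le> GV_bar n \<delta> f A K"
      unfolding GV_bar_eq using collections_mem[OF S] collections_mono[OF S \<open>A \<subseteq> K\<close>]
      by (intro SUP_upper) (auto simp: S_def)
    moreover have "gv_sum n f K L \<le> ennreal (real (card Z) * W)"
    proof -
      have floor: "\<lfloor>c / \<delta>\<rfloor> < \<lfloor>c' / \<delta>\<rfloor>" if "(c, d) \<in> L" "d \<le> c'" for c d c'
      proof -
        have "c + \<delta> < c'"
          using that by (auto simp: L_def S_def)
        then have "(c + \<delta>) / \<delta> \<le> c' / \<delta>"
          using \<open>\<delta> > 0\<close> by (intro divide_right_mono) auto
        then have "c / \<delta> + 1 \<le> c' / \<delta>"
          using \<open>\<delta> > 0\<close> by (simp add: add_divide_distrib)
        then have "\<lfloor>c / \<delta> + 1\<rfloor> \<le> \<lfloor>c' / \<delta>\<rfloor>"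
          by (rule floor_mono)
        then show ?thesis by simp
      qed
      have "card L \<le> card Z"
      proof (rule card_inj_on_le)
        show "inj_on (\<lambda>q. \<lfloor>fst q / \<delta>\<rfloor>) L"
        proof (rule inj_onI)
          fix q q' assume q: "q \<in> L" "q' \<in> L" and eq: "\<lfloor>fst q / \<delta>\<rfloor> = \<lfloor>fst q' / \<delta>\<rfloor>"
          show "q = q'"
            using nonoverlapping_disj[OF collections_nonoverlapping[OF P], of q q']
              floor[of "fst q" "snd q" "fst q'"] floor[of "fst q'" "snd q'" "fst q"] q eq
            by (auto simp: L_def)
        qed
        show "(\<lambda>q. \<lfloor>fst q / \<delta>\<rfloor>) ` L \<subseteq> Z"
        proof clarify
          fix c d assume "(c, d) \<in> L"
          then have "a \<le> c" "c \<le> b"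
            using collections_mem[OF P, of c d] assms(2,3) by (auto simp: L_def)
          then show "\<lfloor>fst (c, d) / \<delta>\<rfloor> \<in> Z"
            using \<open>\<delta> > 0\<close> by (auto simp: Z_def intro!: floor_mono divide_right_mono)
        qed
      qed (simp add: Z_def)
      have "(\<Sum>(x, y) \<in> L. subvar \<alpha> f K x y powr p) \<le> (\<Sum>q \<in> L. W)"
        unfolding W_def using p subvar_le[OF fin'] subvar_nonneg
        by (intro sum_mono) (auto intro!: powr_mono2)
      also have "\<dots> = real (card L) * W" by simp
      also have "\<dots> \<le> real (card Z) * W"
        using \<open>card L \<le> card Z\<close> by (intro mult_right_mono) (auto simp: W_def)
      finally show ?thesis
        unfolding gv_sum_eq[OF fin] by (simp add: \<alpha>_def p_def ennreal_leI)
    qed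
    moreover have "gv_sum n f K P \<le> gv_sum n f K S + gv_sum n f K L"
      using finP by (intro gv_sum_Un_le) (auto simp: L_def S_def)
    ultimately show ?thesis
      by (meson add_mono order_trans)
  qed
  then have "GV n f A K \<le> GV_bar n \<delta> f A K + ennreal (real (card Z) * W)"
    unfolding GV_eq by (rule SUP_least)
  also have "\<dots> < \<infinity>"
    using bar by simp
  finally show ?thesis .
qed

theorem corollary4p2:
  fixes f :: "real \<Rightarrow> real" and a b :: real and n :: nat
  assumes "a \<le> b" and "n \<ge> 2"
  shows "CBVG n a b f \<longleftrightarrow> SBVG n a b f"
proof
  let ?K = "varying_monotonicity a b f"
  have K: "?K \<subseteq> {a..b}"
    by (auto simp: varying_monotonicity_def)
  {
    assume "CBVG n a b f"
    note C = this[unfolded CBVG_def Let_def]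
    note cont = C[THEN conjunct1] and fin = C[THEN conjunct2, THEN conjunct1]
    obtain M :: "nat set" and A where MA: "(\<forall>m\<in>M. closed (A m) \<and> A m \<subseteq> ?K) \<and>
        ?K = (\<Union>m\<in>M. A m) \<and> (\<forall>m\<in>M. GV n f (A m) ?K < \<infinity>)"
      using C[THEN conjunct2, THEN conjunct2] by (elim exE) (rule that)
    then have A: "\<And>m. m \<in> M \<Longrightarrow> closed (A m)" "\<And>m. m \<in> M \<Longrightarrow> A m \<subseteq> ?K"
        "\<And>m. m \<in> M \<Longrightarrow> GV n f (A m) ?K < \<infinity>"
      by blast+
    from MA have UN: "?K = (\<Union>m\<in>M. A m)"
      by (elim conjE)
    have ucont: "uniformly_continuous_on ?K f"
      using compact_uniformly_continuous[OF cont] K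
      unfolding uniformly_continuous_on_def by (meson compact_Icc subsetD)
    define B where "B m = (\<Union>i\<in>M \<inter> {..m}. A i)" for m
    have "((\<lambda>\<delta>. GV_bar n \<delta> f (B m) ?K) \<longlongrightarrow> 0) (at_right 0)" for m
      unfolding B_def using A fin ucont \<open>n \<ge> 2\<close>
      by (intro GV_bar_UN_tendsto_0 GV_bar_tendsto_0) auto
    then have lt: "\<forall>\<^sub>F \<delta> in at_right 0. GV_bar n \<delta> f (B m) ?K < ennreal (1 / real (Suc m))" for m
      by (rule order_tendstoD) simp
    have rng: "\<forall>\<^sub>F \<delta> in at_right 0. 0 < \<delta> \<and> \<delta> < 1 / real (Suc m)" for m
      by (auto simp: eventually_at_right_field intro!: exI[of _ "1 / real (Suc m)"])
    have "\<exists>\<delta>. GV_bar n \<delta> f (B m) ?K < ennreal (1 / real (Suc m)) \<and>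
        0 < \<delta> \<and> \<delta> < 1 / real (Suc m)" for m
      by (rule eventually_happens'[OF _ eventually_conj[OF lt rng]]) simp
    then obtain \<delta> where \<delta>: "\<And>m. GV_bar n (\<delta> m) f (B m) ?K < ennreal (1 / real (Suc m))"
      "\<And>m. 0 < \<delta> m" "\<And>m. \<delta> m < 1 / real (Suc m)"
      by metis
    have lim: "(\<lambda>m. 1 / real (Suc m)) \<longlonglongrightarrow> 0"
      using LIMSEQ_inverse_real_of_nat by (simp add: inverse_eq_divide)
    have "\<delta> \<longlonglongrightarrow> 0"
      using \<delta>(2,3)
      by (intro tendsto_sandwich[OF _ _ tendsto_const lim] always_eventually allI less_imp_le)
    moreover have "(\<lambda>m. GV_bar n (\<delta> m) f (B m) ?K) \<longlonglongrightarrow> 0"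
    proof (rule tendsto_sandwich[OF _ _ tendsto_const])
      show "(\<lambda>m. ennreal (1 / real (Suc m))) \<longlonglongrightarrow> 0"
        using tendsto_ennrealI[OF lim] by simp
      show "\<forall>\<^sub>F m in sequentially. GV_bar n (\<delta> m) f (B m) ?K \<le> ennreal (1 / real (Suc m))"
        using \<delta>(1) by (intro always_eventually allI less_imp_le)
    qed simp
    moreover have "?K = (\<Union>m. B m)"
      by (subst UN) (auto simp: B_def)
    moreover have "closed (B m) \<and> B m \<subseteq> ?K" "B m \<subseteq> B (Suc m)" for m
      using A by (auto simp: B_def)
    ultimately show "SBVG n a b f"
      unfolding SBVG_def Let_def using cont fin \<delta>(2) by blast
  next
    assume "SBVG n a b f"
    note C = this[unfolded SBVG_def Let_def]
    note cont = C[THEN conjunct1] and fin = C[THEN conjunct2, THEN conjunct1]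
    obtain A :: "nat \<Rightarrow> real set" and \<delta> where MA: "(\<forall>m. closed (A m) \<and> A m \<subseteq> ?K) \<and>
        (\<forall>m. \<delta> m > 0) \<and> ?K = (\<Union>m. A m) \<and> \<delta> \<longlonglongrightarrow> 0 \<and> (\<forall>m. A m \<subseteq> A (Suc m)) \<and>
        (\<lambda>m. GV_bar n (\<delta> m) f (A m) ?K) \<longlonglongrightarrow> 0"
      using C[THEN conjunct2, THEN conjunct2] by (elim exE) (rule that)
    then have A: "\<And>m. closed (A m)" "\<And>m. A m \<subseteq> ?K" "\<And>m. A m \<subseteq> A (Suc m)"
      and \<delta>: "\<And>m. \<delta> m > 0"
      and lim: "(\<lambda>m. GV_bar n (\<delta> m) f (A m) ?K) \<longlonglongrightarrow> 0"
      by blast+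
    from MA have UN: "?K = (\<Union>m. A m)"
      by (elim conjE)
    obtain m0 where m0: "\<And>m. m \<ge> m0 \<Longrightarrow> GV_bar n (\<delta> m) f (A m) ?K < 1"
      using order_tendstoD(2)[OF lim, of 1] unfolding eventually_sequentially by auto
    have gv: "GV n f (A m) ?K < \<infinity>" if "m \<ge> m0" for m
      using m0[OF that] A(2) K \<delta> fin \<open>n \<ge> 2\<close>
      by (intro GV_finite[where \<delta> = "\<delta> m"]) (auto intro: less_trans)
    have un: "?K = (\<Union>m\<in>{m0..}. A m)"
    proof -
      have "A m \<subseteq> (\<Union>m\<in>{m0..}. A m)" for m
      proof -
        have "A m \<subseteq> A (max m m0)"
          by (rule lift_Suc_mono_le[of A, OF A(3)]) simp
        also have "\<dots> \<subseteq> (\<Union>m\<in>{m0..}. A m)"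
          by (rule UN_upper) simp
        finally show ?thesis .
      qed
      then have "(\<Union>m. A m) = (\<Union>m\<in>{m0..}. A m)"
        by blast
      with UN show ?thesis
        by (rule trans)
    qed
    show "CBVG n a b f"
      unfolding CBVG_def Let_def
      by (intro conjI exI[of _ "{m0..}"] exI[of _ A] ballI cont fin un gv A(1,2)) simp
  }
qed

end
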